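(* Let $f\geq 1$ be an integer, let $\alpha\in\mathrm{GF}(2^f)$, and let $\Gamma=\Gamma(f,\alpha)=\mathrm{Cos}(G,L,Lg_\alpha L)$. Then $\Gamma$ is bipartite and cubic, and, if $\Gamma$ is connected, then it has diameter at least $6f-3$. Moreover, $G^+=T^2$, $G\leq\mathrm{Aut}(\Gamma)$ (that is, $G$ acts faithfully on $\Gamma$ by right multiplication), and $|V\Gamma|=2^{2f}(2^{2f}-1)^2/3$.
   Context: Let $T=\mathrm{PSL}(2,2^f)$, viewed as the group of permutations $t_{p,q,r,s}:x\mapsto \frac{px+q}{rx+s}$ of $\mathrm{GF}(2^f)\cup\{\infty\}$ with $p,q,r,s\in\mathrm{GF}(2^f)$, $ps-qr\neq0$ (usual conventions for $\infty$). Permutations act on the right, and $x^y=y^{-1}xy$. Put $a=t_{1,1,1,0}$, $b=t_{1,1,0,1}$ (so $\langle a,b\rangle=\mathrm{PSL}(2,2)\cong S_3$) and $u_\alpha=t_{1,\alpha,0,1}$ for $\alpha\in\mathrm{GF}(2^f)$. Let $G=T^2\rtimes\langle\pi\rangle$, where $\pi$ has order $2$ and $(x,y)^\pi=(y,x)$ for $(x,y)\in T^2$; let $L=\langle(a,a),(b,b)\rangle<T^2$ and $g_\alpha=(u_\alpha,bu_\alpha)\pi\in G$; then $Lg_\alpha L=Lg_\alpha^{-1}L$. For a group $X$, subgroup $Y$ and $g\in X$ with $YgY=Yg^{-1}Y$, the coset graph $\mathrm{Cos}(X,Y,YgY)$ has as vertices the right cosets of $Y$ in $X$, with $Yx_1,Yx_2$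 adjacent iff $x_2x_1^{-1}\in YgY$; $X$ acts on it by right multiplication. A graph is cubic if it is regular of valency $3$. Here $G^+$ denotes the index two subgroup of $G$ fixing setwise each half of the bipartition of $V\Gamma$ into $\{Lx\mid x\in T^2\}$ and $\{Lx\mid x\in G\setminus T^2\}$. *)

theory Defs
  imports
    "HOL-Algebra.Algebra"
    "HOL-Algebra.Elementary_Groups"
    "HOL-Library.Cardinality"
    "Graph_Theory.Graph_Theory"
begin

section \<open>The group of fractional linear permutations\<close>

text \<open>The projective line over \<open>'a\<close> is \<open>'a option\<close>, with \<open>None\<close> for the point at infinity.\<close>

definition moebius :: "'a::field \<Rightarrow> 'a \<Rightarrow> 'a \<Rightarrow> 'a \<Rightarrow> 'a option \<Rightarrow> 'a option" where
  "moebius p q r s x = (case x of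
      None \<Rightarrow> (if r = 0 then None else Some (p / r))
    | Some y \<Rightarrow> (if r * y + s = 0 then None else Some ((p * y + q) / (r * y + s))))"

text \<open>Permutations act on the right, so the product of \<open>x\<close> and \<open>y\<close> is ``first \<open>x\<close>, then \<open>y\<close>''.
  All nonzero determinants are allowed; over a finite field of characteristic 2 this group
  is PSL(2), because every element is a square there.\<close>

definition PSL2 :: "('a::field option \<Rightarrow> 'a option) monoid" where
  "PSL2 = \<lparr>carrier = {moebius p q r s | p q r s. p * s - q * r \<noteq> 0},
           monoid.mult = (\<lambda>x y. y \<circ> x), one = id\<rparr>"

definition perm_a :: "'a::field option \<Rightarrow> 'a option" where
  "perm_a = moebius 1 1 1 0"

definition perm_b :: "'a::field option \<Rightarrow> 'a option" where
  "perm_b = moebius 1 1 0 1"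

definition perm_u :: "'a::field \<Rightarrow> 'a option \<Rightarrow> 'a option" where
  "perm_u \<alpha> = moebius 1 \<alpha> 0 1"

section \<open>The semidirect product\<close>

text \<open>For a right action \<open>\<phi> h n\<close> of \<open>H\<close> on \<open>N\<close>, written \<open>n\<^sup>h\<close> on paper, the pair \<open>(n, h)\<close> stands for
  the product \<open>n h\<close>. With \<open>n\<^sup>h\<close> equal to \<open>h\<close>-inverse times \<open>n h\<close>, moving \<open>h\<close> past \<open>n'\<close> in
  \<open>n h n' h'\<close> replaces \<open>n'\<close> by its image under the inverse of \<open>h\<close>.\<close>

definition semidirect ::
  "('n, 'c) monoid_scheme \<Rightarrow> ('h, 'd) monoid_scheme \<Rightarrow> ('h \<Rightarrow> 'n \<Rightarrow> 'n) \<Rightarrow> ('n \<times> 'h) monoid" where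
  "semidirect N H \<phi> =
    \<lparr>carrier = carrier N \<times> carrier H,
     monoid.mult = (\<lambda>(n, h) (n', h'). (n \<otimes>\<^bsub>N\<^esub> \<phi> (inv\<^bsub>H\<^esub> h) n', h \<otimes>\<^bsub>H\<^esub> h')),
     one = (\<one>\<^bsub>N\<^esub>, \<one>\<^bsub>H\<^esub>)\<rparr>"

type_synonym 'a base_elt = "('a option \<Rightarrow> 'a option) \<times> ('a option \<Rightarrow> 'a option)"
type_synonym 'a wreath_elt = "'a base_elt \<times> int"

definition swap_action :: "int \<Rightarrow> 'a base_elt \<Rightarrow> 'a base_elt" where
  "swap_action h = (if h = 0 then id else prod.swap)"

definition GG :: "('a::field) wreath_elt monoid" where
  "GG = semidirect (PSL2 \<times>\<times> PSL2) (integer_mod_group 2) swap_action"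

definition embed :: "('a::field) base_elt \<Rightarrow> 'a wreath_elt" where
  "embed n = (n, \<one>\<^bsub>integer_mod_group 2\<^esub>)"

definition pi_elt :: "('a::field) wreath_elt" where
  "pi_elt = (\<one>\<^bsub>PSL2 \<times>\<times> PSL2\<^esub>, 1)"

definition T_squared :: "('a::field) wreath_elt set" where
  "T_squared = embed ` carrier (PSL2 \<times>\<times> PSL2)"

definition LL :: "('a::field) wreath_elt set" where
  "LL = generate GG {embed (perm_a, perm_a), embed (perm_b, perm_b)}"

definition g_elt :: "'a::field \<Rightarrow> 'a wreath_elt" where
  "g_elt \<alpha> = embed (perm_u \<alpha>, perm_b \<otimes>\<^bsub>PSL2\<^esub> perm_u \<alpha>) \<otimes>\<^bsub>GG\<^esub> pi_elt"

section \<open>Coset graphs\<close>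

definition double_coset :: "('x, 'm) monoid_scheme \<Rightarrow> 'x set \<Rightarrow> 'x \<Rightarrow> 'x set" where
  "double_coset M K g = (K #>\<^bsub>M\<^esub> g) <#>\<^bsub>M\<^esub> K"

text \<open>Undirected graphs are symmetric digraphs. Membership of \<open>x2\<close> times the inverse of \<open>x1\<close> in the
  double coset does not depend on the coset representatives.\<close>

definition coset_graph :: "('x, 'm) monoid_scheme \<Rightarrow> 'x set \<Rightarrow> 'x set \<Rightarrow> 'x set pair_pre_digraph" where
  "coset_graph M K D =
    \<lparr>pverts = rcosets\<^bsub>M\<^esub> K,
     parcs = {(K #>\<^bsub>M\<^esub> x1, K #>\<^bsub>M\<^esub> x2) | x1 x2.
                x1 \<in> carrier M \<and> x2 \<in> carrier M \<and> x2 \<otimes>\<^bsub>M\<^esub> inv\<^bsub>M\<^esub> x1 \<in> D}\<rparr>"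

definition Gamma :: "'a::field \<Rightarrow> 'a wreath_elt set pair_pre_digraph" where
  "Gamma \<alpha> = coset_graph GG LL (double_coset GG LL (g_elt \<alpha>))"

definition right_mult_action ::
  "('x, 'm) monoid_scheme \<Rightarrow> 'x set \<Rightarrow> 'x \<Rightarrow> 'x set \<Rightarrow> 'x set" where
  "right_mult_action M K x = (\<lambda>C \<in> rcosets\<^bsub>M\<^esub> K. C #>\<^bsub>M\<^esub> x)"

section \<open>Graph notions\<close>

definition regular_of_valency :: "'v pair_pre_digraph \<Rightarrow> nat \<Rightarrow> bool" where
  "regular_of_valency \<Delta> k \<longleftrightarrow> (\<forall>v \<in> pverts \<Delta>. out_degree (with_proj \<Delta>) v = k)"

definition cubic :: "'v pair_pre_digraph \<Rightarrow> bool" where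
  "cubic \<Delta> \<longleftrightarrow> regular_of_valency \<Delta> 3"

definition bipartition :: "'v pair_pre_digraph \<Rightarrow> 'v set \<Rightarrow> 'v set \<Rightarrow> bool" where
  "bipartition \<Delta> A B \<longleftrightarrow> A \<union> B = pverts \<Delta> \<and> A \<inter> B = {} \<and>
     parcs \<Delta> \<subseteq> (A \<times> B) \<union> (B \<times> A)"

definition bipartite :: "'v pair_pre_digraph \<Rightarrow> bool" where
  "bipartite \<Delta> \<longleftrightarrow> (\<exists>A B. bipartition \<Delta> A B)"

text \<open>The distance is the least length of a walk, \<open>\<infinity>\<close> if there is none.\<close>

definition diameter :: "'v pair_pre_digraph \<Rightarrow> ereal" where
  "diameter \<Delta> = (SUP u \<in> pverts \<Delta>. SUP v \<in> pverts \<Delta>. wf_digraph.\<mu> (with_proj \<Delta>) (\<lambda>_. 1) u v)"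

text \<open>Automorphisms are composed from left to right, as permutations acting on the right.\<close>

definition Aut :: "'v pair_pre_digraph \<Rightarrow> ('v \<Rightarrow> 'v) monoid" where
  "Aut \<Delta> =
    \<lparr>carrier = {\<sigma> \<in> Bij (pverts \<Delta>). \<forall>u \<in> pverts \<Delta>. \<forall>v \<in> pverts \<Delta>.
                  (\<sigma> u, \<sigma> v) \<in> parcs \<Delta> \<longleftrightarrow> (u, v) \<in> parcs \<Delta>},
     monoid.mult = (\<lambda>\<sigma> \<tau>. compose (pverts \<Delta>) \<tau> \<sigma>),
     one = (\<lambda>v \<in> pverts \<Delta>. v)\<rparr>"

section \<open>The two halves and their stabiliser\<close>

definition half0 :: "('a::field) wreath_elt set set" where
  "half0 = {LL #>\<^bsub>GG\<^esub> x | x. x \<in> T_squared}"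

definition half1 :: "('a::field) wreath_elt set set" where
  "half1 = {LL #>\<^bsub>GG\<^esub> x | x. x \<in> carrier GG - T_squared}"

definition G_plus :: "('a::field) wreath_elt set" where
  "G_plus = {x \<in> carrier GG. right_mult_action GG LL x ` half0 = half0 \<and>
                             right_mult_action GG LL x ` half1 = half1}"

end

(*
  The diameter bound is the Moore bound: a ball of radius n in a cubic graph has at most 3 * 2^n - 2
  vertices, which for n = 6 f - 4 is less than the number q^2 (q^2 - 1)^2 / 3 of vertices, q = 2^f.

  For the valency, g = g_alpha satisfies g^2 = (b,b), so the adjacency relation is symmetric, and g
  conjugates (x,x) into L iff x commutes with b, because u_alpha commutes with b. Hence L meets its
  conjugate by g in a subgroup of order 2, and the valency is 6 / 2. The action is faithful because its
  kernel lies in L and is normal in G, so that it consists of pairs (x,x) with x central in T.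
*)

theory Submission
  imports Defs "HOL-Number_Theory.Residues"
begin

section \<open>The projective line and PSL(2)\<close>

text \<open>The diameter estimate is tightest at q = 2. For n = 6 f - 4 the leading term 3 * 2^n of
  the ball bound equals 3 q^6 / 16, and the number of vertices is at least 3 q^6 / 16 because q^2 -
  1 \<ge> 3 q^2 / 4. At q = 2 both numbers are 12, so there the contradiction rests on the
  subtracted 2 of the ball bound, which has to be carried along exactly. The group computations face
  another obstacle: elements of T are functions with special values at infinity, and a matrix is
  determined by its function only up to a scalar. Homogeneous coordinates turn composition into
  matrix multiplication, and values at a few points tell functions apart. In computing g_alpha^2 and
  the valency, u_alpha enters through two properties, being an involution and commuting with b. This
  is why the outcome is the same for every \<alpha>.\<close>

definition homog :: "'a::field \<Rightarrow> 'a \<Rightarrow> 'a option" where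
  "homog u v = (if v = 0 then None else Some (u / v))"

lemma homog_cases:
  obtains u v where "x = homog u v" "u \<noteq> 0 \<or> v \<noteq> 0"
proof (cases x)
  case None
  then have "x = homog 1 0" by (simp add: homog_def)
  then show ?thesis using that by force
next
  case (Some y)
  then have "x = homog y 1" by (simp add: homog_def)
  then show ?thesis using that by force
qed

text \<open>The matrix acts linearly on the vector (u, v) that represents the point u / v, so the
  case distinctions of \<open>moebius\<close> at infinity are settled here. The zero vector is
  excluded because \<open>homog\<close> sends it to \<open>None\<close> as a mere default.\<close>

lemma moebius_homog:
  assumes "u \<noteq> 0 \<or> v \<noteq> 0"
  shows "moebius p q r s (homog u v) = homog (p * u + q * v) (r * u + s * v)"
proof (cases "v = 0")
  case False
  have "r * (u / v) + s = (r * u + s * v) / v" "p * (u / v) + q = (p * u + q * v) / v"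
    using False by (simp_all add: field_simps)
  then show ?thesis
    using False by (simp add: homog_def moebius_def)
qed (use assms in \<open>auto simp: homog_def moebius_def\<close>)

text \<open>Multiplying the image vector by the adjugate matrix returns the determinant times (u,
  v). This keeps homogeneous coordinates admissible after one map, ready for the next.\<close>

lemma linear_image_nonzero:
  fixes u v :: "'a::field"
  assumes "p * s - q * r \<noteq> 0" "u \<noteq> 0 \<or> v \<noteq> 0"
  shows "p * u + q * v \<noteq> 0 \<or> r * u + s * v \<noteq> 0"
proof (rule ccontr)
  assume "\<not> ?thesis"
  then have z: "p * u + q * v = 0" "r * u + s * v = 0" by auto
  have "(p * s - q * r) * u = s * (p * u + q * v) - q * (r * u + s * v)"
    "(p * s - q * r) * v = p * (r * u + s * v) - r * (p * u + q * v)"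
    by (simp_all add: algebra_simps)
  with z assms show False by simp
qed

lemma moebius_comp:
  assumes "p * s - q * r \<noteq> 0"
  shows "moebius p' q' r' s' \<circ> moebius p q r s =
    moebius (p' * p + q' * r) (p' * q + q' * s) (r' * p + s' * r) (r' * q + s' * s)"
proof
  fix x :: "'a option"
  obtain u v where "x = homog u v" "u \<noteq> 0 \<or> v \<noteq> 0"
    by (rule homog_cases)
  with linear_image_nonzero[OF assms]
  show "(moebius p' q' r' s' \<circ> moebius p q r s) x =
    moebius (p' * p + q' * r) (p' * q + q' * s) (r' * p + s' * r) (r' * q + s' * s) x"
    by (simp add: moebius_homog) (simp add: algebra_simps)
qed

lemma moebius_id: "moebius 1 0 0 1 = id"
  by (auto simp: moebius_def fun_eq_iff split: option.split)

lemma moebius_scale: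
  assumes "c \<noteq> 0"
  shows "moebius (c * p) (c * q) (c * r) (c * s) = moebius p q r s"
proof
  fix x :: "'a option"
  obtain u v where "x = homog u v" "u \<noteq> 0 \<or> v \<noteq> 0"
    by (rule homog_cases)
  moreover have "homog (c * y) (c * z) = homog y z" for y z
    using assms by (simp add: homog_def)
  ultimately show "moebius (c * p) (c * q) (c * r) (c * s) x = moebius p q r s x"
    by (simp add: moebius_homog mult.assoc flip: distrib_left)
qed

lemma PSL2_simps [simp]:
  "x \<otimes>\<^bsub>PSL2\<^esub> y = y \<circ> x" "\<one>\<^bsub>PSL2\<^esub> = id"
  by (simp_all add: PSL2_def)

lemma moebius_in_PSL2: "p * s - q * r \<noteq> 0 \<Longrightarrow> moebius p q r s \<in> carrier PSL2"
  by (auto simp: PSL2_def)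

lemma in_PSL2E:
  assumes "x \<in> carrier PSL2"
  obtains p q r s where "x = moebius p q r s" "p * s - q * r \<noteq> 0"
  using assms by (auto simp: PSL2_def)

text \<open>The adjugate inverts a matrix up to the determinant, a scalar that
  \<open>moebius_scale\<close> removes.\<close>

lemma moebius_inverse:
  fixes p q r s :: "'a::field"
  assumes "p * s - q * r \<noteq> 0"
  shows "moebius s (- q) (- r) p \<circ> moebius p q r s = id"
proof -
  have "moebius s (- q) (- r) p \<circ> moebius p q r s =
    moebius ((p * s - q * r) * 1) ((p * s - q * r) * 0) ((p * s - q * r) * 0) ((p * s - q * r) * 1)"
    by (simp add: moebius_comp[OF assms] algebra_simps)
  then show ?thesis
    by (simp only: moebius_scale[OF assms] moebius_id)
qed

lemma PSL2_group: "group (PSL2 :: ('a::field option \<Rightarrow> 'a option) monoid)"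
proof (rule groupI)
  fix x y :: "'a option \<Rightarrow> 'a option" assume xy: "x \<in> carrier PSL2" "y \<in> carrier PSL2"
  obtain p q r s where x: "x = moebius p q r s" "p * s - q * r \<noteq> 0"
    using xy(1) by (rule in_PSL2E)
  obtain p' q' r' s' where y: "y = moebius p' q' r' s'" "p' * s' - q' * r' \<noteq> 0"
    using xy(2) by (rule in_PSL2E)
  \<comment> \<open>Multiplicativity of the determinant.\<close>
  have "(p' * p + q' * r) * (r' * q + s' * s) - (p' * q + q' * s) * (r' * p + s' * r)
      = (p' * s' - q' * r') * (p * s - q * r)"
    by (simp add: algebra_simps)
  then show "x \<otimes>\<^bsub>PSL2\<^esub> y \<in> carrier PSL2"
    using x y by (simp add: moebius_comp moebius_in_PSL2)
next
  show "\<one>\<^bsub>PSL2\<^esub> \<in> carrier (PSL2 :: ('a option \<Rightarrow> 'a option) monoid)"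
    using moebius_in_PSL2[of 1 1 0 0] by (simp add: moebius_id)
next
  fix x :: "'a option \<Rightarrow> 'a option" assume "x \<in> carrier PSL2"
  then obtain p q r s where x: "x = moebius p q r s" and d: "p * s - q * r \<noteq> 0"
    by (rule in_PSL2E)
  have d': "s * p - (- q) * (- r) \<noteq> 0" using d by (simp add: mult.commute)
  show "\<exists>y\<in>carrier PSL2. y \<otimes>\<^bsub>PSL2\<^esub> x = \<one>\<^bsub>PSL2\<^esub>"
    using moebius_inverse[OF d'] moebius_in_PSL2[OF d']
    by (auto simp: x)
qed (auto simp: comp_assoc)

section \<open>The order of PSL(2,q)\<close>

text \<open>Scaling normalises the bottom row to (0, 1) or (1, s). In the second family the
  determinant \<open>d\<close> replaces the entry q = p s - d as a parameter, so that both parameter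
  sets are Cartesian products and easy to count.\<close>

lemma PSL2_carrier_normal_forms:
  "carrier (PSL2 :: ('a::field option \<Rightarrow> 'a option) monoid) =
    (\<lambda>(p, q). moebius p q 0 1) ` ((UNIV - {0}) \<times> UNIV) \<union>
    (\<lambda>((p, s), d). moebius p (p * s - d) 1 s) ` (UNIV \<times> (UNIV - {0}))" (is "_ = ?A \<union> ?B")
proof (intro equalityI subsetI)
  fix x :: "'a option \<Rightarrow> 'a option" assume "x \<in> carrier PSL2"
  then obtain p q r s where x: "x = moebius p q r s" and d: "p * s - q * r \<noteq> 0"
    by (rule in_PSL2E)
  show "x \<in> ?A \<union> ?B"
  proof (cases "r = 0")
    case True
    with d have "s \<noteq> 0" "p \<noteq> 0" by auto
    then have "x = moebius (p / s) (q / s) 0 1" "p / s \<noteq> 0"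
      using moebius_scale[of s "p / s" "q / s" 0 1] True x by simp_all
    then show ?thesis by (force simp: image_iff)
  next
    case False
    have "x = moebius (p / r) (q / r) 1 (s / r)"
      using moebius_scale[of r "p / r" "q / r" 1 "s / r"] False x by simp
    moreover have "q / r = (p / r) * (s / r) - (p * s - q * r) / (r * r)"
      using False by (simp add: field_simps)
    moreover have "(p * s - q * r) / (r * r) \<noteq> 0"
      using d False by simp
    ultimately have "x \<in> ?B"
      by (intro image_eqI[of _ _ "((p / r, s / r), (p * s - q * r) / (r * r))"]) auto
    then show ?thesis ..
  qed
next
  fix x assume "x \<in> ?A \<union> ?B"
  then show "x \<in> carrier PSL2"
    by (auto intro!: moebius_in_PSL2)
qed

lemma moebius_affine_inject:
  assumes "moebius p q 0 1 = moebius p' q' 0 1"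
  shows "p = p'" "q = q'"
  using fun_cong[OF assms, of "Some 0"] fun_cong[OF assms, of "Some 1"]
  by (simp_all add: moebius_def)

text \<open>Three points recover the parameters: infinity goes to p, the pole is -s, and at 1 - s
  the denominator is 1 and the value is p - d.\<close>

lemma moebius_nonaffine_inject:
  assumes eq: "moebius p (p * s - d) 1 s = moebius p' (p' * s' - d') 1 s'"
  shows "p = p'" "s = s'" "d = d'"
proof -
  from fun_cong[OF eq, of None] show p: "p = p'" by (simp add: moebius_def)
  from fun_cong[OF eq, of "Some (- s)"] show s: "s = s'"
    by (simp add: moebius_def eq_neg_iff_add_eq_0 add_eq_0_iff split: if_splits)
  from fun_cong[OF eq, of "Some (1 - s)"] show "d = d'"
    by (simp add: moebius_def p s algebra_simps)
qed

lemma card_PSL2: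
  "card (carrier (PSL2 :: ('a::{field, finite} option \<Rightarrow> 'a option) monoid)) =
    CARD('a) * (CARD('a) ^ 2 - 1)"
proof -
  let ?f = "\<lambda>(p, q). moebius p q 0 1 :: 'a option \<Rightarrow> 'a option"
  let ?g = "\<lambda>((p, s), d). moebius p (p * s - d) 1 s :: 'a option \<Rightarrow> 'a option"
  let ?A = "?f ` ((UNIV - {0}) \<times> UNIV)" and ?B = "?g ` (UNIV \<times> (UNIV - {0}))"
  have "inj_on ?f ((UNIV - {0}) \<times> UNIV)"
    by (auto simp: inj_on_def dest: moebius_affine_inject)
  then have A: "card ?A = (CARD('a) - 1) * CARD('a)"
    by (simp add: card_image card_cartesian_product)
  have "inj_on ?g (UNIV \<times> (UNIV - {0}))"
    by (auto simp: inj_on_def dest: moebius_nonaffine_inject)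
  then have B: "card ?B = CARD('a) * CARD('a) * (CARD('a) - 1)"
    by (simp add: card_image card_cartesian_product flip: UNIV_Times_UNIV)
  \<comment> \<open>Infinity is fixed by the maps of the first family and moved by those of the
    second.\<close>
  have "?A \<inter> ?B = {}"
    by (auto simp: moebius_def dest!: fun_cong[where x = None])
  then have "card (carrier (PSL2 :: ('a option \<Rightarrow> 'a option) monoid)) = card ?A + card ?B"
    unfolding PSL2_carrier_normal_forms by (subst card_Un_disjoint) auto
  \<comment> \<open>The sum is (q - 1) q + q^2 (q - 1); the case split on q resolves the truncated
    subtraction.\<close>
  also have "\<dots> = CARD('a) * (CARD('a) ^ 2 - 1)"
    by (cases "CARD('a)") (auto simp: A B power2_eq_square algebra_simps)
  finally show ?thesis .
qed

text \<open>The characteristic is a prime divisor of the order of the field. The facts about L and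
  the graph are derived from 2 = 0, so the exponent f returns only in the final arithmetic.\<close>

lemma two_eq_zero_if_card:
  assumes "CARD('a::{field, finite}) = 2 ^ f"
  shows "(2::'a) = 0"
proof -
  have "Factorial_Ring.prime CHAR('a)"
    by (rule prime_CHAR_semidom) (simp add: finite_imp_CHAR_pos)
  moreover have "CHAR('a) dvd 2 ^ f"
    using CHAR_dvd_CARD[where 'a = 'a] assms by simp
  ultimately have "CHAR('a) = 2"
    by (metis prime_dvd_power primes_dvd_imp_eq two_is_prime_nat)
  then have "of_nat 2 = (0::'a)"
    by (metis of_nat_CHAR)
  then show ?thesis by simp
qed

section \<open>The wreath product and the subgroup L\<close>

text \<open>The reversed order in \<open>comp\<close> is that of a right action; combined with the
  inverse of h in the product of \<open>semidirect\<close> it yields associativity.\<close>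

lemma semidirect_group:
  assumes N: "group N" and H: "group H"
    and hom: "\<And>h. h \<in> carrier H \<Longrightarrow> \<phi> h \<in> hom N N"
    and one: "\<And>n. n \<in> carrier N \<Longrightarrow> \<phi> \<one>\<^bsub>H\<^esub> n = n"
    and comp: "\<And>h k n. h \<in> carrier H \<Longrightarrow> k \<in> carrier H \<Longrightarrow> n \<in> carrier N \<Longrightarrow>
      \<phi> (h \<otimes>\<^bsub>H\<^esub> k) n = \<phi> k (\<phi> h n)"
  shows "group (semidirect N H \<phi>)"
proof -
  interpret N: group N by (rule N)
  interpret H: group H by (rule H)
  have closed: "\<phi> h n \<in> carrier N" if "h \<in> carrier H" "n \<in> carrier N" for h n
    using hom that by (auto simp: hom_def)
  have mult: "\<phi> h (n \<otimes>\<^bsub>N\<^esub> n') = \<phi> h n \<otimes>\<^bsub>N\<^esub> \<phi> h n'"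
    if "h \<in> carrier H" "n \<in> carrier N" "n' \<in> carrier N" for h n n'
    using hom that by (auto simp: hom_def)
  show ?thesis
  proof (rule groupI)
    fix x assume "x \<in> carrier (semidirect N H \<phi>)"
    then obtain n h where x: "x = (n, h)" and nh: "n \<in> carrier N" "h \<in> carrier H"
      by (auto simp: semidirect_def)
    \<comment> \<open>The inverse of n h is h^-1 n^-1, that is, the image of n^-1 under h followed
      by h^-1. This is the witness used below.\<close>
    have "inv\<^bsub>N\<^esub> (\<phi> h n) \<otimes>\<^bsub>N\<^esub> \<phi> (inv\<^bsub>H\<^esub> (inv\<^bsub>H\<^esub> h)) n = \<one>\<^bsub>N\<^esub>"
      using nh closed by simp
    then show "\<exists>y\<in>carrier (semidirect N H \<phi>). y \<otimes>\<^bsub>semidirect N H \<phi>\<^esub> x = \<one>\<^bsub>semidirect N H \<phi>\<^esub>"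
      using nh closed x
      by (intro bexI[of _ "(inv\<^bsub>N\<^esub> (\<phi> h n), inv\<^bsub>H\<^esub> h)"]) (auto simp: semidirect_def)
  qed (use closed mult one comp in \<open>auto simp: semidirect_def N.m_assoc H.m_assoc H.inv_mult_group\<close>)
qed

lemma carrier_GG: "carrier GG = (carrier PSL2 \<times> carrier PSL2) \<times> {0, 1}"
  by (auto simp: GG_def semidirect_def carrier_integer_mod_group)

lemma one_GG: "\<one>\<^bsub>GG\<^esub> = ((id, id), 0)"
  by (simp add: GG_def semidirect_def)

text \<open>Composition appears reversed because the left factor of a product in \<open>PSL2\<close>
  acts before the right one. A left factor outside T^2 swaps the components of the right factor, 1
  being its own inverse modulo 2.\<close>

lemma mult_GG:
  "((x, y), 0) \<otimes>\<^bsub>GG\<^esub> ((x', y'), k) = ((x' \<circ> x, y' \<circ> y), k mod 2)"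
  "((x, y), 1) \<otimes>\<^bsub>GG\<^esub> ((x', y'), k) = ((y' \<circ> x, x' \<circ> y), (1 + k) mod 2)"
  by (simp_all add: GG_def semidirect_def swap_action_def carrier_integer_mod_group)

lemma GG_group: "group (GG :: 'a::field wreath_elt monoid)"
  unfolding GG_def
proof (rule semidirect_group)
  show "group (PSL2 \<times>\<times> PSL2 :: 'a base_elt monoid)"
    by (intro DirProd_group PSL2_group)
next
  have "carrier (integer_mod_group 2) = {0, 1}"
    by (auto simp: carrier_integer_mod_group)
  then show "swap_action (h \<otimes>\<^bsub>integer_mod_group 2\<^esub> k) n = swap_action k (swap_action h n)"
    if "h \<in> carrier (integer_mod_group 2)" "k \<in> carrier (integer_mod_group 2)"
    for h k and n :: "'a base_elt"
    using that by (auto simp: swap_action_def)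
qed (auto simp: swap_action_def hom_def)

lemma embed_eq: "embed n = (n, 0)"
  by (simp add: embed_def)

lemma T_squared_eq: "T_squared = (carrier PSL2 \<times> carrier PSL2) \<times> {0}"
  by (auto simp: T_squared_def embed_eq)

lemma card_GG: "card (carrier (GG :: 'a::{field, finite} wreath_elt monoid)) =
    2 * card (carrier (PSL2 :: ('a option \<Rightarrow> 'a option) monoid)) ^ 2"
  by (simp add: carrier_GG card_cartesian_product power2_eq_square)

lemma LL_subgroup: "subgroup (LL :: 'a::field wreath_elt set) GG"
  unfolding LL_def
  by (intro group.generate_is_subgroup[OF GG_group])
    (auto simp: embed_eq carrier_GG perm_a_def perm_b_def intro: moebius_in_PSL2)

lemma g_elt_eq: "g_elt \<alpha> = ((perm_u \<alpha>, perm_u \<alpha> \<circ> perm_b), 1)"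
  by (simp add: g_elt_def embed_eq pi_elt_def mult_GG)

lemma g_elt_carrier: "g_elt \<alpha> \<in> carrier (GG :: 'a::field wreath_elt monoid)"
  by (auto simp: g_elt_eq carrier_GG perm_b_def perm_u_def moebius_comp intro!: moebius_in_PSL2)

text \<open>Both are translations, by \<alpha> and by 1.\<close>

lemma perm_u_b_commute: "perm_u \<alpha> \<circ> perm_b = perm_b \<circ> (perm_u \<alpha> :: 'a::field option \<Rightarrow> 'a option)"
  by (simp add: perm_u_def perm_b_def moebius_comp add.commute)

text \<open>The copy of PSL(2,2) is described by the matrices with entries in \<open>{0, 1}\<close>, a set that is closed
  under the ring operations in characteristic 2.\<close>

definition PSL22 :: "('a::field option \<Rightarrow> 'a option) set" where
  "PSL22 = {moebius p q r s | p q r s. {p, q, r, s} \<subseteq> {0, 1} \<and> p * s - q * r \<noteq> 0}"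

lemma PSL22I:
  "{p, q, r, s} \<subseteq> {0, 1} \<Longrightarrow> p * s - q * r \<noteq> 0 \<Longrightarrow> moebius p q r s \<in> PSL22"
  unfolding PSL22_def by blast

lemma PSL22E:
  assumes "x \<in> PSL22"
  obtains p q r s where "x = moebius p q r s" "{p, q, r, s} \<subseteq> {0, 1}" "p * s - q * r \<noteq> 0"
  using assms unfolding PSL22_def by blast

context
  assumes char2: "(2::'a::field) = 0"
begin

lemma double_zero: "x + x = (0::'a)"
  by (simp add: char2 flip: mult_2)

lemma minus_self: "- x = (x::'a)"
  using double_zero by (simp add: minus_unique)

lemma PSL22_subgroup: "subgroup (PSL22 :: ('a option \<Rightarrow> 'a option) set) PSL2"
proof (rule group.subgroupI[OF PSL2_group])
  show "PSL22 \<subseteq> carrier (PSL2 :: ('a option \<Rightarrow> 'a option) monoid)"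
    by (auto simp: PSL22_def PSL2_def)
  have "id \<in> (PSL22 :: ('a option \<Rightarrow> 'a option) set)"
    using PSL22I[of 1 0 0 1] by (simp add: moebius_id)
  then show "PSL22 \<noteq> ({} :: ('a option \<Rightarrow> 'a option) set)" by blast
next
  fix x :: "'a option \<Rightarrow> 'a option" assume "x \<in> PSL22"
  then obtain p q r s where x: "x = moebius p q r s" "{p, q, r, s} \<subseteq> {0, 1}"
      and d: "p * s - q * r \<noteq> 0"
    by (rule PSL22E)
  have d': "s * p - (- q) * (- r) \<noteq> 0" using d by (simp add: mult.commute)
  have "inv\<^bsub>PSL2\<^esub> x = moebius s (- q) (- r) p"
    using moebius_inverse[OF d'] moebius_in_PSL2[OF d'] moebius_in_PSL2[OF d] x
    by (intro group.inv_equality[OF PSL2_group]) auto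
  moreover have "moebius s (- q) (- r) p \<in> PSL22"
    using x(2) by (intro PSL22I d') (simp add: minus_self)
  ultimately show "inv\<^bsub>PSL2\<^esub> x \<in> PSL22" by simp
next
  fix x y :: "'a option \<Rightarrow> 'a option" assume xy: "x \<in> PSL22" "y \<in> PSL22"
  obtain p q r s where x: "x = moebius p q r s" "{p, q, r, s} \<subseteq> {0, 1}" and d: "p * s - q * r \<noteq> 0"
    using xy(1) by (rule PSL22E)
  obtain p' q' r' s' where y: "y = moebius p' q' r' s'" "{p', q', r', s'} \<subseteq> {0, 1}"
      and d': "p' * s' - q' * r' \<noteq> 0"
    using xy(2) by (rule PSL22E)
  have "(p' * p + q' * r) * (r' * q + s' * s) - (p' * q + q' * s) * (r' * p + s' * r)
      = (p' * s' - q' * r') * (p * s - q * r)"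
    by (simp add: algebra_simps)
  then have d'': "(p' * p + q' * r) * (r' * q + s' * s) - (p' * q + q' * s) * (r' * p + s' * r) \<noteq> 0"
    using d d' by simp
  have cl: "u * v + w * z \<in> {0, 1}" if "{u, v, w, z} \<subseteq> {0, 1}" for u v w z :: 'a
    using that by (auto simp: char2)
  have "y \<circ> x = moebius (p' * p + q' * r) (p' * q + q' * s) (r' * p + s' * r) (r' * q + s' * s)"
    by (simp only: x y moebius_comp[OF d])
  moreover have "{p' * p + q' * r, p' * q + q' * s, r' * p + s' * r, r' * q + s' * s} \<subseteq> {0, 1}"
    using x(2) y(2) by (intro insert_subsetI cl empty_subsetI) simp_all
  then have "moebius (p' * p + q' * r) (p' * q + q' * s) (r' * p + s' * r) (r' * q + s' * s) \<in> PSL22"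
    by (rule PSL22I[OF _ d''])
  ultimately show "x \<otimes>\<^bsub>PSL2\<^esub> y \<in> PSL22"
    by simp
qed

text \<open>Of the sixteen matrices with entries 0 and 1, exactly six are invertible in
  characteristic 2: these form GL(2,2).\<close>

lemma PSL22_explicit:
  "(PSL22 :: ('a option \<Rightarrow> 'a option) set) =
    {moebius 1 0 0 1, moebius 1 1 0 1, moebius 1 1 1 0, moebius 0 1 1 1, moebius 1 0 1 1,
     moebius 0 1 1 0}"
proof -
  have "x \<in> {moebius 1 0 0 1, moebius 1 1 0 1, moebius 1 1 1 0, moebius 0 1 1 1, moebius 1 0 1 1,
     moebius 0 1 1 0}" if "x \<in> PSL22" for x :: "'a option \<Rightarrow> 'a option"
  proof -
    from that obtain p q r s where "x = moebius p q r s" "{p, q, r, s} \<subseteq> {0, 1}"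
      and "p * s - q * r \<noteq> 0"
      by (rule PSL22E)
    moreover from this have "p = 0 \<or> p = 1" "q = 0 \<or> q = 1" "r = 0 \<or> r = 1" "s = 0 \<or> s = 1"
      by simp_all
    ultimately show ?thesis by (elim disjE) simp_all
  qed
  then show ?thesis
    by (intro equalityI subsetI) (blast, elim insertE emptyE, simp_all add: PSL22I)
qed

text \<open>The six maps permute infinity, 0 and 1, so the images of infinity and 0 already separate
  them.\<close>

lemma card_PSL22: "card (PSL22 :: ('a option \<Rightarrow> 'a option) set) = 6"
proof -
  have "distinct (map (\<lambda>x. (x None, x (Some 0)))
    [moebius 1 0 0 1, moebius 1 1 0 1, moebius 1 1 1 0, moebius 0 1 1 1, moebius 1 0 1 1,
     moebius 0 1 1 0 :: 'a option \<Rightarrow> 'a option])"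
    by (simp add: moebius_def)
  then have "distinct [moebius 1 0 0 1, moebius 1 1 0 1, moebius 1 1 1 0, moebius 0 1 1 1, moebius 1 0 1 1,
     moebius 0 1 1 0 :: 'a option \<Rightarrow> 'a option]"
    unfolding distinct_map by blast
  from distinct_card[OF this] show ?thesis
    by (simp add: PSL22_explicit)
qed

lemma PSL22_generate: "generate PSL2 {perm_a, perm_b} = (PSL22 :: ('a option \<Rightarrow> 'a option) set)"
proof (rule group.generateI[OF PSL2_group PSL22_subgroup, symmetric])
  show "{perm_a, perm_b} \<subseteq> (PSL22 :: ('a option \<Rightarrow> 'a option) set)"
    by (simp add: PSL22_explicit perm_a_def perm_b_def)
next
  fix K assume K: "subgroup K (PSL2 :: ('a option \<Rightarrow> 'a option) monoid)" and ab: "{perm_a, perm_b} \<subseteq> K"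
  have mult: "y \<circ> x \<in> K" if "x \<in> K" "y \<in> K" for x y
    using subgroup.m_closed[OF K that] by simp
  have a: "moebius 1 1 1 0 \<in> K" and b: "moebius 1 1 0 1 \<in> K"
    using ab by (simp_all add: perm_a_def perm_b_def)
  \<comment> \<open>The six elements are 1, a, a^2, b, ba and ba^2, with a of order 3 and b of order
    2.\<close>
  have aa: "moebius 0 1 1 1 \<in> K"
    using mult[OF a a] by (simp add: moebius_comp char2)
  have "moebius 1 0 1 1 \<in> K" "moebius 0 1 1 0 \<in> K" "moebius 1 0 0 1 \<in> K"
    using mult[OF b a] mult[OF b aa] mult[OF b b] by (simp_all add: moebius_comp char2)
  with a b aa show "PSL22 \<subseteq> K"
    by (simp add: PSL22_explicit)
qed

text \<open>The diagonal map is a homomorphism from T to G, and a homomorphism carries generated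
  subgroups to generated subgroups. This reduces L to generation inside T.\<close>

lemma LL_eq: "LL = (\<lambda>x. ((x, x), 0)) ` (PSL22 :: ('a option \<Rightarrow> 'a option) set)"
proof -
  let ?d = "\<lambda>x :: 'a option \<Rightarrow> 'a option. ((x, x), 0 :: int)"
  have "group_hom PSL2 GG ?d"
    by (intro group_hom.intro group_hom_axioms.intro PSL2_group GG_group)
      (auto simp: hom_def carrier_GG mult_GG)
  moreover have "{perm_a, perm_b} \<subseteq> carrier (PSL2 :: ('a option \<Rightarrow> 'a option) monoid)"
    by (auto simp: perm_a_def perm_b_def intro: moebius_in_PSL2)
  ultimately have "generate GG (?d ` {perm_a, perm_b}) = ?d ` generate PSL2 {perm_a, perm_b}"
    by (rule group_hom.generate_img)
  then show ?thesis
    by (simp add: LL_def embed_eq PSL22_generate)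
qed

lemma card_LL: "card (LL :: 'a wreath_elt set) = 6"
  unfolding LL_eq by (subst card_image) (auto simp: inj_on_def card_PSL22)

text \<open>This is the centraliser of a transposition in S_3. The map b fixes infinity and swaps 0
  and 1, whereas the other four elements send infinity to 0 or 1; evaluation at infinity thus
  refutes commutation.\<close>

lemma PSL22_commutes_b:
  "{x \<in> PSL22. x \<circ> perm_b = perm_b \<circ> x} = {id, perm_b :: 'a option \<Rightarrow> 'a option}"
proof -
  have "x \<circ> perm_b \<noteq> perm_b \<circ> x" if "x \<in> {moebius 1 1 1 0, moebius 0 1 1 1, moebius 1 0 1 1, moebius 0 1 1 0}"
    for x :: "'a option \<Rightarrow> 'a option"
    using that char2 by (auto simp: perm_b_def moebius_def dest!: fun_cong[where x = None])
  then show ?thesis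
    by (auto simp: PSL22_explicit perm_b_def moebius_id)
qed

section \<open>The element g_alpha and its action on L\<close>

lemma perm_u_involution: "perm_u \<alpha> \<circ> perm_u \<alpha> = (id :: 'a option \<Rightarrow> 'a option)"
  by (simp add: perm_u_def moebius_comp double_zero moebius_id)

lemma g_elt_square: "g_elt \<alpha> \<otimes>\<^bsub>GG\<^esub> g_elt \<alpha> \<in> (LL :: 'a wreath_elt set)"
proof -
  have "perm_u \<alpha> \<circ> perm_b \<circ> perm_u \<alpha> = (perm_b :: 'a option \<Rightarrow> 'a option)"
    "perm_u \<alpha> \<circ> (perm_u \<alpha> \<circ> perm_b) = (perm_b :: 'a option \<Rightarrow> 'a option)"
    by (metis perm_u_b_commute perm_u_involution comp_assoc comp_id id_comp)+
  then have "g_elt \<alpha> \<otimes>\<^bsub>GG\<^esub> g_elt \<alpha> = ((perm_b, perm_b), 0 :: int)"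
    by (simp add: g_elt_eq mult_GG)
  then show ?thesis
    by (simp add: LL_eq PSL22_explicit perm_b_def)
qed

text \<open>The set on the left is the intersection of L with its conjugate by g, written without
  inverses so that membership becomes a pair of equations between components.\<close>

lemma g_elt_normalises:
  "{k \<in> LL. g_elt \<alpha> \<otimes>\<^bsub>GG\<^esub> k \<in> LL #>\<^bsub>GG\<^esub> g_elt \<alpha>} =
    (\<lambda>x. ((x, x), 0)) ` {id, perm_b :: 'a option \<Rightarrow> 'a option}"
proof -
  let ?u = "perm_u \<alpha> :: 'a option \<Rightarrow> 'a option" and ?b = "perm_b :: 'a option \<Rightarrow> 'a option"
  have ub: "?u \<circ> ?b = ?b \<circ> ?u" by (rule perm_u_b_commute)
  have iff: "(\<exists>y\<in>PSL22. x \<circ> ?u = ?u \<circ> y \<and> x \<circ> (?u \<circ> ?b) = ?u \<circ> ?b \<circ> y) \<longleftrightarrow> x \<circ> ?b = ?b \<circ> x"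
    if x: "x \<in> PSL22" for x
  proof
    assume "\<exists>y\<in>PSL22. x \<circ> ?u = ?u \<circ> y \<and> x \<circ> (?u \<circ> ?b) = ?u \<circ> ?b \<circ> y"
    then obtain y where y: "x \<circ> ?u = ?u \<circ> y" "x \<circ> (?u \<circ> ?b) = ?u \<circ> ?b \<circ> y" by blast
    \<comment> \<open>The first equation eliminates y from the second: u b y = b u y = b x u as
      composed functions. Cancelling the involution u then leaves the commutation of x and
      b.\<close>
    have "x \<circ> ?b \<circ> ?u = ?u \<circ> ?b \<circ> y"
      using y(2) by (simp only: ub comp_assoc)
    also have "\<dots> = ?b \<circ> x \<circ> ?u"
      by (simp only: ub comp_assoc y(1))
    finally have "x \<circ> ?b \<circ> (?u \<circ> ?u) = ?b \<circ> x \<circ> (?u \<circ> ?u)"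
      by (simp only: flip: comp_assoc)
    then show "x \<circ> ?b = ?b \<circ> x" by (simp only: perm_u_involution comp_id)
  next
    assume "x \<circ> ?b = ?b \<circ> x"
    then have "x = id \<or> x = ?b" using x PSL22_commutes_b by blast
    \<comment> \<open>Both candidates commute with u, so y = x is a witness.\<close>
    then have "x \<circ> ?u = ?u \<circ> x \<and> x \<circ> (?u \<circ> ?b) = ?u \<circ> ?b \<circ> x"
    proof
      assume "x = id"
      then show ?thesis by simp
    next
      assume x: "x = ?b"
      show ?thesis unfolding x by (simp only: ub comp_assoc simp_thms)
    qed
    with x show "\<exists>y\<in>PSL22. x \<circ> ?u = ?u \<circ> y \<and> x \<circ> (?u \<circ> ?b) = ?u \<circ> ?b \<circ> y"
      by blast
  qed
  have "g_elt \<alpha> \<otimes>\<^bsub>GG\<^esub> ((x, x), 0) \<in> LL #>\<^bsub>GG\<^esub> g_elt \<alpha> \<longleftrightarrow>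
      (\<exists>y\<in>PSL22. x \<circ> ?u = ?u \<circ> y \<and> x \<circ> (?u \<circ> ?b) = ?u \<circ> ?b \<circ> y)" for x
    unfolding LL_eq r_coset_def g_elt_eq by (simp add: mult_GG)
  then have "{k \<in> LL. g_elt \<alpha> \<otimes>\<^bsub>GG\<^esub> k \<in> LL #>\<^bsub>GG\<^esub> g_elt \<alpha>} =
    (\<lambda>x. ((x, x), 0)) ` {x \<in> PSL22. x \<circ> ?b = ?b \<circ> x}"
    using iff by (auto simp: LL_eq)
  then show ?thesis by (simp only: PSL22_commutes_b)
qed

end

section \<open>Balls in cubic graphs\<close>

primrec closed_ball :: "'v rel \<Rightarrow> 'v \<Rightarrow> nat \<Rightarrow> 'v set" where
  "closed_ball R u 0 = {u}"
| "closed_ball R u (Suc n) = closed_ball R u n \<union> R `` closed_ball R u n"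

lemma finite_closed_ball:
  assumes "\<And>v. finite (R `` {v})"
  shows "finite (closed_ball R u n)"
proof (induction n)
  case (Suc n)
  have "R `` closed_ball R u n = (\<Union>v\<in>closed_ball R u n. R `` {v})" by blast
  then show ?case using Suc assms by simp
qed simp

lemma closed_ball_mono: "m \<le> n \<Longrightarrow> closed_ball R u m \<subseteq> closed_ball R u n"
  by (rule lift_Suc_mono_le) auto

text \<open>By symmetry every vertex of one sphere has a neighbour in the preceding ball, so at most
  k of its at most k + 1 neighbours are new.\<close>

lemma card_sphere_le:
  assumes "sym R" and fin: "\<And>v. finite (R `` {v})" and deg: "\<And>v. card (R `` {v}) \<le> Suc k"
  shows "card (closed_ball R u (Suc n) - closed_ball R u n) \<le> Suc k * k ^ n"
proof (induction n)
  case 0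
  have "card (R `` {u} - {u}) \<le> card (R `` {u})"
    by (intro card_mono fin) auto
  with deg[of u] show ?case
    by (simp add: insert_Diff_if Un_Diff)
next
  case (Suc n)
  let ?B = "closed_ball R u"
  let ?S = "?B (Suc n) - ?B n"
  have finS: "finite ?S"
    using finite_closed_ball[OF fin] by blast
  have "?B (Suc (Suc n)) - ?B (Suc n) \<subseteq> (\<Union>x\<in>?S. R `` {x} - ?B (Suc n))"
    by auto
  then have "card (?B (Suc (Suc n)) - ?B (Suc n)) \<le> card (\<Union>x\<in>?S. R `` {x} - ?B (Suc n))"
    using finS fin by (intro card_mono) auto
  also have "\<dots> \<le> (\<Sum>x\<in>?S. card (R `` {x} - ?B (Suc n)))"
    by (rule card_UN_le[OF finS])
  also have "\<dots> \<le> (\<Sum>x\<in>?S. k)"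
  proof (rule sum_mono)
    fix x assume "x \<in> ?S"
    then obtain y where y: "y \<in> ?B n" "(y, x) \<in> R" by auto
    with \<open>sym R\<close> have yx: "y \<in> R `` {x}" by (auto dest: symD)
    have "card (R `` {x} - ?B (Suc n)) \<le> card (R `` {x} - {y})"
      using y(1) by (intro card_mono finite_Diff fin) auto
    also have "\<dots> \<le> k"
      using deg[of x] yx fin by simp
    finally show "card (R `` {x} - ?B (Suc n)) \<le> k" .
  qed
  also have "\<dots> \<le> Suc k * k ^ n * k"
    using Suc.IH by simp
  finally show ?case by (simp only: power_Suc mult_ac)
qed

text \<open>Summing the spheres gives 1 + 3 (1 + 2 + ... + 2^(n-1)) = 3 * 2^n - 2. The 2 stands on
  the left to avoid truncated subtraction.\<close>

lemma card_closed_ball_cubic_le: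
  assumes "sym R" and fin: "\<And>v. finite (R `` {v})" and deg: "\<And>v. card (R `` {v}) \<le> 3"
  shows "card (closed_ball R u n) + 2 \<le> 3 * 2 ^ n"
proof (induction n)
  case (Suc n)
  have "closed_ball R u (Suc n) = closed_ball R u n \<union> (closed_ball R u (Suc n) - closed_ball R u n)"
    by auto
  then have "card (closed_ball R u (Suc n)) \<le>
      card (closed_ball R u n) + card (closed_ball R u (Suc n) - closed_ball R u n)"
    by (metis card_Un_le)
  also have "card (closed_ball R u (Suc n) - closed_ball R u n) \<le> 3 * 2 ^ n"
    using card_sphere_le[of R 2 u n] assms by (simp add: eval_nat_numeral)
  finally show ?case using Suc by simp
qed simp

section \<open>Walks and the diameter\<close>

context pair_wf_digraph
begin

lemma awalk_in_closed_ball: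
  assumes "awalk u p v"
  shows "v \<in> closed_ball (parcs G) u (length p)"
  using assms
proof (induction p arbitrary: v rule: rev_induct)
  case (snoc e p)
  then have "awalk u p (fst e)" "e \<in> parcs G" "snd e = v"
    by (auto simp: awalk_simps awalk_append_iff awalk_Cons_iff)
  with snoc.IH have "fst e \<in> closed_ball (parcs G) u (length p)" "(fst e, v) \<in> parcs G"
    by auto
  then show ?case by auto
qed (auto simp: awalk_Nil_iff)

text \<open>An infimum strictly below a bound is witnessed by a walk below that bound. The infimum
  over no walks is infinite, so existence of a walk is included.\<close>

lemma exists_short_walk:
  assumes "\<mu> (\<lambda>_. 1) u v < ereal (real n)"
  obtains p where "awalk u p v" "length p < n"
proof -
  from assms obtain p where p: "awalk u p v" "awalk_cost (\<lambda>_. 1) p < real n"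
    unfolding \<mu>_def INF_less_iff by auto
  have "awalk_cost (\<lambda>_. 1 :: real) p = length p"
    by (simp add: awalk_cost_def sum_list_triv)
  with p that show ?thesis by simp
qed

text \<open>Walk lengths are integers, so a distance strictly below n + 1 provides a walk of length
  at most n.\<close>

lemma verts_subset_closed_ball:
  assumes "diameter G < ereal (real (Suc n))" "u \<in> pverts G"
  shows "pverts G \<subseteq> closed_ball (parcs G) u n"
proof
  fix v assume v: "v \<in> pverts G"
  have "\<mu> (\<lambda>_. 1) u v \<le> diameter G"
    unfolding diameter_def by (intro SUP_upper2[OF assms(2)] SUP_upper2[OF v] order_refl)
  with assms(1) have "\<mu> (\<lambda>_. 1) u v < ereal (real (Suc n))" by (rule order_le_less_trans[rotated])
  then obtain p where "awalk u p v" "length p < Suc n"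
    by (rule exists_short_walk)
  then show "v \<in> closed_ball (parcs G) u n"
    using awalk_in_closed_ball[of u p v] closed_ball_mono[of "length p" n "parcs G" u] by auto
qed

end

lemma out_degree_with_proj: "out_degree (with_proj \<Delta>) v = card (parcs \<Delta> `` {v})"
proof -
  have "out_arcs (with_proj \<Delta>) v = Pair v ` (parcs \<Delta> `` {v})"
    by (auto simp: out_arcs_def)
  then show ?thesis
    by (simp add: out_degree_def card_image inj_on_def)
qed

lemma (in pair_graph) cubic_diameter_bound:
  assumes "cubic G" "diameter G < ereal (real (Suc n))"
  shows "card (pverts G) + 2 \<le> 3 * 2 ^ n"
proof (cases "pverts G = {}")
  case True
  have "(1::nat) \<le> 2 ^ n" by simp
  then have "2 \<le> 3 * (2::nat) ^ n" by linarith
  then show ?thesis using True by simp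
next
  case False
  then obtain u where u: "u \<in> pverts G" by blast
  have fin: "finite (parcs G `` {v})" for v
    using pair_finite_arcs by (rule finite_Image)
  have deg: "card (parcs G `` {v}) \<le> 3" for v
  proof (cases "v \<in> pverts G")
    case True
    then show ?thesis
      using assms(1) by (simp add: cubic_def regular_of_valency_def out_degree_with_proj)
  next
    case False
    \<comment> \<open>Values of the type that are not vertices have no outgoing arcs, so the degree
      bound holds for all \<open>v\<close>, as the ball estimate demands.\<close>
    then have "parcs G `` {v} = {}" by (auto dest: in_arcsD1)
    then show ?thesis by simp
  qed
  have "sym (parcs G)"
    using arcs_symmetric by (auto intro: symI)
  then have "card (closed_ball (parcs G) u n) + 2 \<le> 3 * 2 ^ n"
    by (rule card_closed_ball_cubic_le[OF _ fin deg])
  moreover have "card (pverts G) \<le> card (closed_ball (parcs G) u n)"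
    using verts_subset_closed_ball[OF assms(2) u] finite_closed_ball[OF fin]
    by (intro card_mono)
  ultimately show ?thesis by simp
qed

section \<open>Coset graphs\<close>

text \<open>Arc preservation is an equivalence, so inserting preimages shows that the inverse map
  preserves arcs too; restricting it to the vertices keeps it extensional.\<close>

lemma Aut_group: "group (Aut \<Delta>)"
proof (rule groupI)
  fix \<sigma> \<tau> assume "\<sigma> \<in> carrier (Aut \<Delta>)" "\<tau> \<in> carrier (Aut \<Delta>)"
  moreover from this have "\<sigma> v \<in> pverts \<Delta>" if "v \<in> pverts \<Delta>" for v
    using that by (auto simp: Aut_def dest: Bij_imp_funcset)
  ultimately show "\<sigma> \<otimes>\<^bsub>Aut \<Delta>\<^esub> \<tau> \<in> carrier (Aut \<Delta>)"
    by (simp add: Aut_def compose_Bij compose_eq)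
next
  show "\<one>\<^bsub>Aut \<Delta>\<^esub> \<in> carrier (Aut \<Delta>)"
    by (simp add: Aut_def id_Bij)
next
  fix \<sigma> \<tau> \<rho>
  assume "\<sigma> \<in> carrier (Aut \<Delta>)" "\<tau> \<in> carrier (Aut \<Delta>)" "\<rho> \<in> carrier (Aut \<Delta>)"
  then show "\<sigma> \<otimes>\<^bsub>Aut \<Delta>\<^esub> \<tau> \<otimes>\<^bsub>Aut \<Delta>\<^esub> \<rho> = \<sigma> \<otimes>\<^bsub>Aut \<Delta>\<^esub> (\<tau> \<otimes>\<^bsub>Aut \<Delta>\<^esub> \<rho>)"
    by (simp add: Aut_def compose_assoc Bij_imp_funcset)
next
  fix \<sigma> assume "\<sigma> \<in> carrier (Aut \<Delta>)"
  then show "\<one>\<^bsub>Aut \<Delta>\<^esub> \<otimes>\<^bsub>Aut \<Delta>\<^esub> \<sigma> = \<sigma>"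
    by (auto simp: Aut_def dest: Bij_imp_funcset Bij_imp_extensional intro!: compose_Id)
next
  fix \<sigma> assume \<sigma>: "\<sigma> \<in> carrier (Aut \<Delta>)"
  let ?V = "pverts \<Delta>"
  let ?\<tau> = "\<lambda>x\<in>?V. inv_into ?V \<sigma> x"
  have B: "\<sigma> \<in> Bij ?V" and im: "\<sigma> ` ?V = ?V"
    using \<sigma> by (auto simp: Aut_def Bij_def bij_betw_def)
  have \<sigma>\<tau>: "\<sigma> (?\<tau> v) = v" "?\<tau> v \<in> ?V" if "v \<in> ?V" for v
    using that B by (auto simp: f_inv_into_f im Bij_inv_into_mem)
  have "(?\<tau> u, ?\<tau> v) \<in> parcs \<Delta> \<longleftrightarrow> (u, v) \<in> parcs \<Delta>" if "u \<in> ?V" "v \<in> ?V" for u v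
  proof -
    have "(\<sigma> (?\<tau> u), \<sigma> (?\<tau> v)) \<in> parcs \<Delta> \<longleftrightarrow> (?\<tau> u, ?\<tau> v) \<in> parcs \<Delta>"
      using \<sigma> \<sigma>\<tau>(2)[OF that(1)] \<sigma>\<tau>(2)[OF that(2)] unfolding Aut_def by simp
    then show ?thesis by (simp only: \<sigma>\<tau>(1)[OF that(1)] \<sigma>\<tau>(1)[OF that(2)])
  qed
  moreover have "compose ?V \<sigma> ?\<tau> = (\<lambda>v\<in>?V. v)"
    using \<sigma>\<tau>(1) by (auto simp: compose_def)
  ultimately show "\<exists>\<tau>\<in>carrier (Aut \<Delta>). \<tau> \<otimes>\<^bsub>Aut \<Delta>\<^esub> \<sigma> = \<one>\<^bsub>Aut \<Delta>\<^esub>"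
    using restrict_inv_into_Bij[OF B]
    by (intro bexI[of _ ?\<tau>]) (simp_all add: Aut_def)
qed

lemma coset_graph_parcsI:
  "\<lbrakk>x \<in> carrier G; y \<in> carrier G; y \<otimes>\<^bsub>G\<^esub> inv\<^bsub>G\<^esub> x \<in> D\<rbrakk> \<Longrightarrow>
    (K #>\<^bsub>G\<^esub> x, K #>\<^bsub>G\<^esub> y) \<in> parcs (coset_graph G K D)"
  unfolding coset_graph_def by auto

context group
begin

text \<open>Adjacency depends on z y^-1, which does not change when y and z are both multiplied by x
  on the right. The converse implication for arcs comes from the same fact for x^-1.\<close>

lemma right_mult_action_hom:
  assumes K: "subgroup K G" and D: "D \<subseteq> carrier G"
  shows "group_hom G (Aut (coset_graph G K D)) (right_mult_action G K)"
proof (intro group_hom.intro group_hom_axioms.intro homI is_group Aut_group)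
  let ?V = "rcosets K" and ?E = "parcs (coset_graph G K D)"
  let ?act = "right_mult_action G K"
  have Ksub: "K \<subseteq> carrier G" using K by (rule subgroup.subset)
  have V: "C #> x \<in> ?V" if "C \<in> ?V" "x \<in> carrier G" for C x
    using that Ksub by (auto simp: RCOSETS_def coset_mult_assoc)
  have Vsub: "C \<subseteq> carrier G" if "C \<in> ?V" for C
    using that Ksub by (auto simp: RCOSETS_def r_coset_def)
  have step: "(C #> x, C' #> x) \<in> ?E" if C: "(C, C') \<in> ?E" and x: "x \<in> carrier G" for C C' x
  proof -
    from C obtain y z where yz: "C = K #> y" "C' = K #> z" "y \<in> carrier G" "z \<in> carrier G"
        "z \<otimes> inv y \<in> D"
      by (auto simp: coset_graph_def)
    have "z \<otimes> x \<otimes> inv (y \<otimes> x) = z \<otimes> (x \<otimes> inv x) \<otimes> inv y"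
      using yz x by (simp only: inv_mult_group m_assoc m_closed inv_closed)
    then have "z \<otimes> x \<otimes> inv (y \<otimes> x) \<in> D"
      using yz x by simp
    then have "(K #> (y \<otimes> x), K #> (z \<otimes> x)) \<in> ?E"
      using yz x by (intro coset_graph_parcsI) simp_all
    then show ?thesis
      using yz x Ksub by (simp add: coset_mult_assoc)
  qed
  have cancel: "C #> x #> inv x = C" "C #> inv x #> x = C" if "C \<in> ?V" "x \<in> carrier G" for C x
    using that Vsub[OF that(1)] by (simp_all add: coset_mult_assoc)
  fix x assume x: "x \<in> carrier G"
  have "bij_betw (?act x) ?V ?V"
    by (rule bij_betw_byWitness[of _ "?act (inv x)"])
      (use x V cancel in \<open>auto simp: right_mult_action_def\<close>)
  then have "?act x \<in> Bij ?V"
    by (simp add: Bij_def right_mult_action_def)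
  moreover have "(?act x C, ?act x C') \<in> ?E \<longleftrightarrow> (C, C') \<in> ?E" if "C \<in> ?V" "C' \<in> ?V" for C C'
    using step[of C C' x] step[of "C #> x" "C' #> x" "inv x"] that x cancel
    by (auto simp: right_mult_action_def)
  ultimately show "?act x \<in> carrier (Aut (coset_graph G K D))"
    by (simp add: Aut_def coset_graph_def)
  fix y assume y: "y \<in> carrier G"
  show "?act (x \<otimes> y) = ?act x \<otimes>\<^bsub>Aut (coset_graph G K D)\<^esub> ?act y"
    unfolding right_mult_action_def Aut_def coset_graph_def compose_def monoid.simps
      pair_pre_digraph.simps
    by (rule restrict_ext) (simp add: x y V Vsub coset_mult_assoc)
qed

context
  fixes K g
  assumes K: "subgroup K G" and g: "g \<in> carrier G" and gg: "g \<otimes> g \<in> K"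
begin

lemma subgroup_carrier: "k \<in> K \<Longrightarrow> k \<in> carrier G"
  using K by (rule subgroup.mem_carrier)

lemma rcos_absorb:
  assumes "k \<in> K" "x \<in> carrier G"
  shows "K #> (k \<otimes> x) = K #> x"
  using assms K subgroup.subset[OF K] by (intro repr_independence[symmetric] rcosI)

text \<open>If y x^-1 = k g k', then k' x represents the same coset as x, and g k' x the same coset
  as y. A good choice of representatives thus eliminates the double coset.\<close>

lemma double_coset_parcs:
  "parcs (coset_graph G K (double_coset G K g)) = {(K #> x, K #> (g \<otimes> x)) | x. x \<in> carrier G}"
    (is "?E = ?R")
proof (intro equalityI subsetI)
  fix e assume "e \<in> ?E"
  then obtain x y k k' where e: "e = (K #> x, K #> y)" "x \<in> carrier G" "y \<in> carrier G"
      and k: "k \<in> K" "k' \<in> K" "y \<otimes> inv x = k \<otimes> g \<otimes> k'"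
    by (auto simp: coset_graph_def double_coset_def r_coset_def set_mult_def)
  have "y = k \<otimes> (g \<otimes> (k' \<otimes> x))"
  proof -
    have "y = y \<otimes> inv x \<otimes> x" using e by (simp add: m_assoc)
    also have "\<dots> = k \<otimes> (g \<otimes> (k' \<otimes> x))"
      using k e g subgroup_carrier by (simp add: m_assoc)
    finally show ?thesis .
  qed
  then have "e = (K #> (k' \<otimes> x), K #> (g \<otimes> (k' \<otimes> x)))" "k' \<otimes> x \<in> carrier G"
    using e k g subgroup_carrier by (simp_all add: rcos_absorb)
  then show "e \<in> ?R" by blast
next
  fix e assume "e \<in> ?R"
  then obtain x where e: "e = (K #> x, K #> (g \<otimes> x))" and x: "x \<in> carrier G" by blast
  have "\<one> \<in> K" using K by (rule subgroup.one_closed)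
  then have "\<one> \<otimes> g \<otimes> \<one> \<in> double_coset G K g"
    unfolding double_coset_def r_coset_def set_mult_def by blast
  moreover have "g \<otimes> x \<otimes> inv x = \<one> \<otimes> g \<otimes> \<one>"
    using x g by (simp add: m_assoc)
  ultimately show "e \<in> ?E"
    unfolding e using x g by (intro coset_graph_parcsI) simp_all
qed

lemma double_coset_subset: "double_coset G K g \<subseteq> carrier G"
  using g subgroup_carrier by (auto simp: double_coset_def r_coset_def set_mult_def)

lemma sym_double_coset_parcs: "sym (parcs (coset_graph G K (double_coset G K g)))"
proof (rule symI)
  fix C C' assume "(C, C') \<in> parcs (coset_graph G K (double_coset G K g))"
  then obtain x where x: "C = K #> x" "C' = K #> (g \<otimes> x)" "x \<in> carrier G"
    by (auto simp: double_coset_parcs)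
  have "K #> (g \<otimes> (g \<otimes> x)) = K #> x"
    using rcos_absorb[OF gg x(3)] g x(3) by (simp add: m_assoc)
  then show "(C', C) \<in> parcs (coset_graph G K (double_coset G K g))"
    unfolding double_coset_parcs using x g by auto
qed

text \<open>An orbit-stabiliser count: k \<mapsto> K g k x maps K onto the neighbours of K x, and
  the fibre through k0 is H k0, where H is the intersection of K with its conjugate by g. The
  valency is therefore the index of H in K, stated as a product.\<close>

lemma card_neighbours:
  assumes "finite K" "C \<in> rcosets K"
  shows "card (parcs (coset_graph G K (double_coset G K g)) `` {C}) *
    card {k \<in> K. g \<otimes> k \<in> K #> g} = card K"
proof -
  obtain x where x: "C = K #> x" "x \<in> carrier G"
    using assms(2) by (auto simp: RCOSETS_def)
  let ?f = "\<lambda>k. K #> (g \<otimes> (k \<otimes> x))"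
  let ?H = "{k \<in> K. g \<otimes> k \<in> K #> g}"
  have nb: "parcs (coset_graph G K (double_coset G K g)) `` {C} = ?f ` K"
  proof (intro equalityI subsetI)
    fix C' assume "C' \<in> parcs (coset_graph G K (double_coset G K g)) `` {C}"
    then obtain y where y: "K #> x = K #> y" "C' = K #> (g \<otimes> y)" "y \<in> carrier G"
      by (auto simp: double_coset_parcs x)
    then have "y \<in> K #> x"
      using repr_independenceD[OF K] by blast
    then show "C' \<in> ?f ` K"
      using y by (auto simp: r_coset_def)
  next
    fix C' assume "C' \<in> ?f ` K"
    then obtain k where k: "k \<in> K" "C' = K #> (g \<otimes> (k \<otimes> x))" by blast
    then have "(K #> (k \<otimes> x), C') \<in> parcs (coset_graph G K (double_coset G K g))"
      using x subgroup_carrier by (auto simp: double_coset_parcs)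
    then show "C' \<in> parcs (coset_graph G K (double_coset G K g)) `` {C}"
      using k x by (simp add: rcos_absorb)
  qed
  have fibre: "{k \<in> K. ?f k = ?f k0} = (\<lambda>h. h \<otimes> k0) ` ?H" if k0: "k0 \<in> K" for k0
  proof -
    have eq: "?f (h \<otimes> k0) = ?f k0 \<longleftrightarrow> g \<otimes> h \<in> K #> g" if h: "h \<in> K" for h
    proof -
      have car: "h \<in> carrier G" "k0 \<in> carrier G" "g \<in> carrier G" "x \<in> carrier G"
        using h k0 subgroup_carrier g x(2) by auto
      have split: "g \<otimes> (h \<otimes> k0 \<otimes> x) = g \<otimes> h \<otimes> (k0 \<otimes> x)"
        using car by (simp add: m_assoc)
      show ?thesis
      proof
        assume "?f (h \<otimes> k0) = ?f k0"
        \<comment> \<open>Right multiplication by the inverse of k0 x cancels the common factor,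
          leaving the condition on h alone.\<close>
        then have "K #> (g \<otimes> h \<otimes> (k0 \<otimes> x)) = K #> (g \<otimes> (k0 \<otimes> x))"
          by (simp only: split)
        then have "K #> (g \<otimes> h) #> (k0 \<otimes> x) #> inv (k0 \<otimes> x) = K #> g #> (k0 \<otimes> x) #> inv (k0 \<otimes> x)"
          using car subgroup.subset[OF K] by (simp add: coset_mult_assoc)
        then have "K #> (g \<otimes> h) = K #> g"
          using car subgroup.subset[OF K] by (simp add: coset_mult_assoc m_assoc)
        then show "g \<otimes> h \<in> K #> g"
          using repr_independenceD[OF K] car by (metis m_closed)
      next
        assume "g \<otimes> h \<in> K #> g"
        then have "K #> (g \<otimes> h) = K #> g"
          using car repr_independence[OF _ _ K] by simp
        then have "K #> (g \<otimes> h) #> (k0 \<otimes> x) = K #> g #> (k0 \<otimes> x)" by simp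
        then show "?f (h \<otimes> k0) = ?f k0"
          using car subgroup.subset[OF K] by (simp add: coset_mult_assoc split)
      qed
    qed
    show ?thesis
    proof (intro equalityI subsetI)
      fix k assume k: "k \<in> {k \<in> K. ?f k = ?f k0}"
      then have kK: "k \<in> K" by simp
      have h: "k \<otimes> inv k0 \<in> K"
        using kK k0 K by (simp add: subgroup.m_closed subgroup.m_inv_closed)
      have "k \<otimes> inv k0 \<otimes> k0 = k"
        using kK k0 subgroup_carrier by (simp add: m_assoc)
      with eq[OF h] h k show "k \<in> (\<lambda>h. h \<otimes> k0) ` ?H"
        by (intro image_eqI[of _ _ "k \<otimes> inv k0"]) simp_all
    next
      fix k assume "k \<in> (\<lambda>h. h \<otimes> k0) ` ?H"
      then show "k \<in> {k \<in> K. ?f k = ?f k0}"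
        using eq k0 K by (auto simp: subgroup.m_closed)
    qed
  qed
  have "card {k \<in> K. ?f k = ?f k0} = card ?H" if k0: "k0 \<in> K" for k0
  proof -
    have "inj_on (\<lambda>h. h \<otimes> k0) ?H"
      using k0 subgroup_carrier by (intro inj_onI) auto
    then show ?thesis by (simp add: fibre[OF k0] card_image)
  qed
  then have "(\<Sum>y\<in>?f ` K. card {k \<in> K. ?f k = y}) = card (?f ` K) * card ?H"
    by (subst sum.cong[where h = "\<lambda>_. card ?H", OF refl]) auto
  then show ?thesis
    using sum.image_gen[OF assms(1), of "\<lambda>_. 1::nat" ?f] by (simp add: nb)
qed

end

end

section \<open>The graph of the theorem\<close>

lemma T_squared_iff: "x \<in> T_squared \<longleftrightarrow> x \<in> carrier GG \<and> snd x = 0"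
  by (cases x) (auto simp: T_squared_eq carrier_GG)

text \<open>The second component is a homomorphism to the integers modulo 2 with kernel T^2; its
  value is the parity that separates the two halves.\<close>

lemma mult_in_T_squared:
  assumes "x \<in> carrier GG" "y \<in> carrier GG"
  shows "x \<otimes>\<^bsub>GG\<^esub> y \<in> T_squared \<longleftrightarrow> (x \<in> T_squared \<longleftrightarrow> y \<in> T_squared)"
proof -
  have "x \<otimes>\<^bsub>GG\<^esub> y \<in> carrier GG"
    using assms group.subgroup_self[OF GG_group] by (rule subgroup.m_closed[rotated])
  then show ?thesis
    using assms by (auto simp: T_squared_iff carrier_GG mult_GG)
qed

context
  fixes \<alpha> :: "'a::{field, finite}"
  assumes char2: "(2::'a) = 0"
begin

interpretation GG: group "GG :: 'a wreath_elt monoid"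
  by (rule GG_group)

lemma LL_subset: "(LL :: 'a wreath_elt set) \<subseteq> T_squared"
  using subgroup.subset[OF LL_subgroup[where 'a = 'a]] by (auto simp: T_squared_iff LL_eq[OF char2])

text \<open>Two representatives of a coset differ by an element of L, which lies in T^2.\<close>

lemma rcoset_parity:
  fixes x y :: "'a wreath_elt"
  assumes "x \<in> carrier GG" "y \<in> carrier GG" "LL #>\<^bsub>GG\<^esub> x = LL #>\<^bsub>GG\<^esub> y"
  shows "x \<in> T_squared \<longleftrightarrow> y \<in> T_squared"
proof -
  have "y \<in> LL #>\<^bsub>GG\<^esub> x"
    using GG.repr_independenceD[OF LL_subgroup[where 'a = 'a] assms(2,3)] .
  then obtain k where k: "k \<in> LL" "y = k \<otimes>\<^bsub>GG\<^esub> x"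
    by (auto simp: r_coset_def)
  then have "k \<in> T_squared" using LL_subset by blast
  then show ?thesis
    using k assms(1) mult_in_T_squared[of k x] by (auto simp: T_squared_iff)
qed

lemma parcs_Gamma:
  "parcs (Gamma \<alpha>) = {(LL #>\<^bsub>GG\<^esub> x, LL #>\<^bsub>GG\<^esub> (g_elt \<alpha> \<otimes>\<^bsub>GG\<^esub> x)) | x. x \<in> carrier GG}"
  unfolding Gamma_def
  by (rule GG.double_coset_parcs[OF LL_subgroup[where 'a = 'a] g_elt_carrier[of \<alpha>] g_elt_square[OF char2]])

lemma pverts_Gamma: "pverts (Gamma \<alpha>) = rcosets\<^bsub>GG\<^esub> LL"
  by (simp add: Gamma_def coset_graph_def)

lemma halves_disjoint: "half0 \<inter> (half1 :: 'a wreath_elt set set) = {}"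
proof (rule equals0I)
  fix C :: "'a wreath_elt set" assume "C \<in> half0 \<inter> half1"
  then obtain x y where "C = LL #>\<^bsub>GG\<^esub> x" "x \<in> T_squared"
      and "C = LL #>\<^bsub>GG\<^esub> y" "y \<in> carrier GG" "y \<notin> T_squared"
    unfolding half0_def half1_def by blast
  then show False
    using rcoset_parity[of x y] by (simp add: T_squared_iff)
qed

text \<open>Every arc joins L x to L g x, and g lies outside T^2, so the two ends have opposite
  parity.\<close>

lemma Gamma_bipartition: "bipartition (Gamma \<alpha>) half0 half1"
  unfolding bipartition_def
proof (intro conjI)
  show "half0 \<union> half1 = pverts (Gamma \<alpha>)"
  proof -
    have "(T_squared :: 'a wreath_elt set) \<subseteq> carrier GG"
      by (auto simp: T_squared_iff)
    then show ?thesis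
      unfolding half0_def half1_def pverts_Gamma RCOSETS_def by blast
  qed
  show "half0 \<inter> (half1 :: 'a wreath_elt set set) = {}"
    by (rule halves_disjoint)
  have "g_elt \<alpha> \<notin> T_squared"
    by (simp add: T_squared_iff g_elt_eq)
  then have "g_elt \<alpha> \<otimes>\<^bsub>GG\<^esub> x \<in> T_squared \<longleftrightarrow> x \<notin> T_squared" if "x \<in> carrier GG" for x
    using mult_in_T_squared[OF g_elt_carrier[of \<alpha>] that] by blast
  moreover have "g_elt \<alpha> \<otimes>\<^bsub>GG\<^esub> x \<in> carrier GG" if "x \<in> carrier GG" for x
    using that g_elt_carrier[of \<alpha>] by simp
  ultimately show "parcs (Gamma \<alpha>) \<subseteq> half0 \<times> half1 \<union> half1 \<times> half0"
    unfolding parcs_Gamma half0_def half1_def by blast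
qed

lemma Gamma_pair_graph: "pair_graph (Gamma \<alpha>)"
proof unfold_locales
  have vs: "half0 \<union> half1 = pverts (Gamma \<alpha>)"
    and es: "parcs (Gamma \<alpha>) \<subseteq> half0 \<times> half1 \<union> half1 \<times> half0"
    using Gamma_bipartition by (auto simp: bipartition_def)
  then have sub: "parcs (Gamma \<alpha>) \<subseteq> pverts (Gamma \<alpha>) \<times> pverts (Gamma \<alpha>)" by blast
  then show "fst e \<in> pverts (Gamma \<alpha>)" "snd e \<in> pverts (Gamma \<alpha>)" if "e \<in> parcs (Gamma \<alpha>)" for e
    using that by auto
  show fin: "finite (pverts (Gamma \<alpha>))"
    by (simp add: pverts_Gamma RCOSETS_def carrier_GG)
  show "finite (parcs (Gamma \<alpha>))"
    using sub fin by (meson finite_SigmaI finite_subset)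
  show "fst e \<noteq> snd e" if "e \<in> parcs (Gamma \<alpha>)" for e
  proof -
    from that es have "e \<in> half0 \<times> half1 \<union> half1 \<times> half0" by (rule rev_subsetD)
    then have "fst e \<in> half0 \<and> snd e \<in> half1 \<or> fst e \<in> half1 \<and> snd e \<in> half0"
      unfolding mem_Times_iff Un_iff .
    then show ?thesis
      using halves_disjoint by (elim disjE conjE) (metis disjoint_iff)+
  qed
  show "symmetric (with_proj (Gamma \<alpha>))"
    using GG.sym_double_coset_parcs[OF LL_subgroup[where 'a = 'a] g_elt_carrier[of \<alpha>] g_elt_square[OF char2]]
    by (simp add: symmetric_def Gamma_def)
qed

lemma Gamma_cubic: "cubic (Gamma \<alpha>)"
proof -
  have "card ((\<lambda>x. ((x, x), 0 :: int)) ` {id, perm_b :: 'a option \<Rightarrow> 'a option}) =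
      card {id, perm_b :: 'a option \<Rightarrow> 'a option}"
    by (intro card_image) (auto simp: inj_on_def)
  moreover have "perm_b (Some (0::'a)) \<noteq> id (Some 0)"
    by (simp add: perm_b_def moebius_def)
  then have "perm_b \<noteq> (id :: 'a option \<Rightarrow> 'a option)" by metis
  ultimately have H: "card {k \<in> LL. g_elt \<alpha> \<otimes>\<^bsub>GG\<^esub> k \<in> LL #>\<^bsub>GG\<^esub> g_elt \<alpha>} = 2"
    unfolding g_elt_normalises[OF char2] by simp
  have "finite (LL :: 'a wreath_elt set)"
    using card_LL[OF char2] by (intro card_ge_0_finite) simp
  then have "card (parcs (Gamma \<alpha>) `` {C}) * 2 = 6" if "C \<in> pverts (Gamma \<alpha>)" for C
    using GG.card_neighbours[OF LL_subgroup[where 'a = 'a] g_elt_carrier[of \<alpha>]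
        g_elt_square[OF char2], of C] that
    by (simp add: H card_LL[OF char2] pverts_Gamma) (simp add: Gamma_def)
  then show ?thesis
    by (auto simp: cubic_def regular_of_valency_def out_degree_with_proj)
qed

text \<open>Lagrange's theorem gives 6 |V| = 2 |T|^2.\<close>

lemma card_Gamma: "card (pverts (Gamma \<alpha>)) * 3 = (CARD('a) * (CARD('a) ^ 2 - 1)) ^ 2"
  using GG.lagrange[OF LL_subgroup[where 'a = 'a]]
  by (simp add: pverts_Gamma card_LL[OF char2] order_def card_GG card_PSL2)

section \<open>The action of G on the vertices\<close>

lemma right_mult_coset:
  fixes x y :: "'a wreath_elt"
  assumes "x \<in> carrier GG" "y \<in> carrier GG"
  shows "right_mult_action GG LL x (LL #>\<^bsub>GG\<^esub> y) = LL #>\<^bsub>GG\<^esub> (y \<otimes>\<^bsub>GG\<^esub> x)"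
  using assms subgroup.subset[OF LL_subgroup[where 'a = 'a]]
  by (simp add: right_mult_action_def GG.coset_mult_assoc GG.rcosetsI)

text \<open>An element x outside T^2 sends the vertex L to L x in the other half, while
  multiplication by an element of T^2 preserves the parity of representatives.\<close>

lemma Gamma_G_plus: "G_plus = (T_squared :: 'a wreath_elt set)"
proof (intro equalityI subsetI)
  fix x :: "'a wreath_elt" assume "x \<in> G_plus"
  then have x: "x \<in> carrier GG" and im: "right_mult_action GG LL x ` half0 = half0"
    by (auto simp: G_plus_def)
  show "x \<in> T_squared"
  proof (rule ccontr)
    assume nx: "x \<notin> T_squared"
    have one: "\<one>\<^bsub>GG\<^esub> \<in> (T_squared :: 'a wreath_elt set)"
      using GG.one_closed by (simp only: T_squared_iff one_GG snd_conv simp_thms)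
    then have "LL #>\<^bsub>GG\<^esub> \<one>\<^bsub>GG\<^esub> \<in> (half0 :: 'a wreath_elt set set)"
      unfolding half0_def by blast
    with im have "right_mult_action GG LL x (LL #>\<^bsub>GG\<^esub> \<one>\<^bsub>GG\<^esub>) \<in> half0" by blast
    then have "LL #>\<^bsub>GG\<^esub> x \<in> half0"
      using right_mult_coset[OF x GG.one_closed] x by simp
    moreover have "LL #>\<^bsub>GG\<^esub> x \<in> half1"
      using x nx unfolding half1_def by blast
    ultimately show False using halves_disjoint by blast
  qed
next
  fix x :: "'a wreath_elt" assume xT: "x \<in> T_squared"
  then have x: "x \<in> carrier GG" by (simp add: T_squared_iff)
  \<comment> \<open>One argument serves both halves, with \<open>A\<close> equal to T^2 or to its
    complement; y x^-1 supplies preimages.\<close>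
  have im: "right_mult_action GG LL x ` {LL #>\<^bsub>GG\<^esub> y | y. y \<in> A} = {LL #>\<^bsub>GG\<^esub> y | y. y \<in> A}"
    if A: "A \<subseteq> carrier GG" and cl: "\<And>y. y \<in> carrier GG \<Longrightarrow> y \<otimes>\<^bsub>GG\<^esub> x \<in> A \<longleftrightarrow> y \<in> A" for A
  proof (intro equalityI subsetI)
    fix C assume "C \<in> right_mult_action GG LL x ` {LL #>\<^bsub>GG\<^esub> y | y. y \<in> A}"
    then obtain y where y: "y \<in> A" "C = right_mult_action GG LL x (LL #>\<^bsub>GG\<^esub> y)" by blast
    then have yc: "y \<in> carrier GG" using A by blast
    have "C = LL #>\<^bsub>GG\<^esub> (y \<otimes>\<^bsub>GG\<^esub> x)" "y \<otimes>\<^bsub>GG\<^esub> x \<in> A"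
      using y cl[OF yc] right_mult_coset[OF x yc] by simp_all
    then show "C \<in> {LL #>\<^bsub>GG\<^esub> y | y. y \<in> A}" by blast
  next
    fix C assume "C \<in> {LL #>\<^bsub>GG\<^esub> y | y. y \<in> A}"
    then obtain y where y: "y \<in> A" "C = LL #>\<^bsub>GG\<^esub> y" by blast
    define z where "z = y \<otimes>\<^bsub>GG\<^esub> inv\<^bsub>GG\<^esub> x"
    have z: "z \<in> carrier GG" "z \<otimes>\<^bsub>GG\<^esub> x = y"
      using x y A by (auto simp: z_def GG.m_assoc)
    then have "z \<in> A" "C = right_mult_action GG LL x (LL #>\<^bsub>GG\<^esub> z)"
      using y cl[OF z(1)] right_mult_coset[OF x z(1)] by auto
    then show "C \<in> right_mult_action GG LL x ` {LL #>\<^bsub>GG\<^esub> y | y. y \<in> A}" by blast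
  qed
  have "right_mult_action GG LL x ` half0 = half0"
    unfolding half0_def
    by (rule im) (use mult_in_T_squared[OF _ x] xT in \<open>auto simp: T_squared_iff\<close>)
  moreover have "right_mult_action GG LL x ` half1 = half1"
    unfolding half1_def
    by (rule im) (use mult_in_T_squared[OF _ x] xT x in auto)
  ultimately show "x \<in> G_plus"
    using x by (simp add: G_plus_def)
qed

lemma Gamma_action_hom: "group_hom GG (Aut (Gamma \<alpha>)) (right_mult_action GG LL)"
  unfolding Gamma_def
  by (intro GG.right_mult_action_hom LL_subgroup[where 'a = 'a]
      GG.double_coset_subset[OF LL_subgroup[where 'a = 'a] g_elt_carrier[of \<alpha>] g_elt_square[OF char2]])

lemma stabiliser_of_coset:
  fixes x y :: "'a wreath_elt"
  assumes "x \<in> carrier GG" "y \<in> carrier GG"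
    and "right_mult_action GG LL x (LL #>\<^bsub>GG\<^esub> y) = LL #>\<^bsub>GG\<^esub> y"
  shows "y \<otimes>\<^bsub>GG\<^esub> x \<in> LL #>\<^bsub>GG\<^esub> y"
  using assms right_mult_coset[OF assms(1,2)]
    GG.repr_independenceD[OF LL_subgroup[where 'a = 'a], of "y \<otimes>\<^bsub>GG\<^esub> x" y] by simp

lemma Gamma_action_faithful:
  "inj_on (right_mult_action GG LL) (carrier (GG :: 'a wreath_elt monoid))"
proof -
  have "x = \<one>\<^bsub>GG\<^esub>" if x: "x \<in> carrier GG"
    and act: "right_mult_action GG LL x = \<one>\<^bsub>Aut (Gamma \<alpha>)\<^esub>" for x :: "'a wreath_elt"
  proof -
    have fix_coset: "y \<otimes>\<^bsub>GG\<^esub> x \<in> LL #>\<^bsub>GG\<^esub> y" if "y \<in> carrier GG" for y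
      using that x subgroup.subset[OF LL_subgroup[where 'a = 'a]]
      by (intro stabiliser_of_coset) (simp_all add: act Aut_def pverts_Gamma GG.rcosetsI)
    have "x \<in> LL"
      using fix_coset[OF GG.one_closed] x subgroup.subset[OF LL_subgroup[where 'a = 'a]]
      by simp
    then obtain k where k: "x = ((k, k), 0)" "k \<in> PSL22"
      by (auto simp: LL_eq[OF char2])
    have comm: "k \<circ> s = s \<circ> k" if "s \<in> carrier PSL2" for s
    proof -
      \<comment> \<open>The vertex L (s, 1) is fixed, so (s, 1)(k, k) = (l, l)(s, 1) for some l. The
        second components give l = k, and then the first ones say that k commutes with s.\<close>
      have "((s, id), 0) \<in> carrier GG"
        using that group.is_monoid[OF PSL2_group, THEN monoid.one_closed]
        by (simp add: carrier_GG)
      from fix_coset[OF this] show ?thesis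
        by (auto simp: k(1) mult_GG r_coset_def LL_eq[OF char2])
    qed
    have "perm_a \<in> carrier (PSL2 :: ('a option \<Rightarrow> 'a option) monoid)"
      "perm_b \<in> carrier (PSL2 :: ('a option \<Rightarrow> 'a option) monoid)"
      by (auto simp: perm_a_def perm_b_def intro: moebius_in_PSL2)
    note ab = this[THEN comm]
    have "k = id \<or> k = perm_b"
      using ab(2) k(2) PSL22_commutes_b[OF char2] by blast
    \<comment> \<open>At infinity, a followed by b gives 0, whereas b followed by a gives 1, so b is
      not central.\<close>
    moreover have "perm_b (perm_a None) \<noteq> perm_a (perm_b (None :: 'a option))"
      using char2 by (simp add: perm_a_def perm_b_def moebius_def)
    then have "k \<noteq> perm_b"
      using fun_cong[OF ab(1), of None] by auto
    ultimately show ?thesis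
      by (simp add: k(1) one_GG)
  qed
  then show ?thesis
    using group_hom.inj_on_one_iff[OF Gamma_action_hom] by blast
qed

end

theorem proposition6p3:
  fixes f :: nat and \<alpha> :: "'a::{field, finite}"
  assumes "f \<ge> 1" and "CARD('a) = 2 ^ f"
  shows "pair_graph (Gamma \<alpha>) \<and>
    bipartite (Gamma \<alpha>) \<and>
    cubic (Gamma \<alpha>) \<and>
    (connected (with_proj (Gamma \<alpha>)) \<longrightarrow> diameter (Gamma \<alpha>) \<ge> ereal (6 * real f - 3)) \<and>
    bipartition (Gamma \<alpha>) half0 half1 \<and>
    G_plus = (T_squared :: 'a wreath_elt set) \<and>
    group_hom GG (Aut (Gamma \<alpha>)) (right_mult_action GG LL) \<and>
    inj_on (right_mult_action GG LL) (carrier (GG :: 'a wreath_elt monoid)) \<and>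
    real (card (pverts (Gamma \<alpha>))) = 2 ^ (2 * f) * (2 ^ (2 * f) - 1)\<^sup>2 / 3"
proof -
  have char2: "(2::'a) = 0"
    by (rule two_eq_zero_if_card[OF assms(2)])
  define q :: nat where "q = 2 ^ f"
  have q2: "2 \<le> q"
    using power_increasing[of 1 f "2::nat"] assms(1) by (simp add: q_def)
  then have "4 \<le> q ^ 2"
    using power_mono[of 2 q 2] by simp
  have card: "card (pverts (Gamma \<alpha>)) * 3 = (q * (q ^ 2 - 1)) ^ 2"
    using card_Gamma[OF char2, of \<alpha>] by (simp add: assms(2) q_def)
  have "diameter (Gamma \<alpha>) \<ge> ereal (6 * real f - 3)"
  proof (rule ccontr)
    assume "\<not> ?thesis"
    moreover define n where "n = 6 * f - 4"
    moreover have "real (Suc n) = 6 * real f - 3"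
      using assms(1) by (simp add: n_def of_nat_diff)
    ultimately have "diameter (Gamma \<alpha>) < ereal (real (Suc n))" by simp
    then have "card (pverts (Gamma \<alpha>)) + 2 \<le> 3 * 2 ^ n"
      by (rule pair_graph.cubic_diameter_bound[OF Gamma_pair_graph[OF char2] Gamma_cubic[OF char2]])
    \<comment> \<open>Equivalent to q^2 \<ge> 4, with equality at q = 2.\<close>
    moreover have le: "3 * q ^ 2 \<le> 4 * (q ^ 2 - 1)"
      using \<open>4 \<le> q ^ 2\<close> by linarith
    \<comment> \<open>The ball bound times 48, using that 3 |V| is known. The factor 16 = 2^4 makes
      up for the 4 in n = 6 f - 4, and the surplus 96 makes the final inequality strict.\<close>
    ultimately have "16 * (q * (q ^ 2 - 1)) ^ 2 + 96 \<le> 9 * (2 ^ n * 16)"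
      using card by linarith
    also have "2 ^ n * 16 = (2::nat) ^ (n + 4)" by (simp add: power_add)
    also have "n + 4 = f * 6" using assms(1) by (simp add: n_def)
    also have "(2::nat) ^ (f * 6) = q ^ 6" by (simp add: q_def power_mult)
    also have "9 * q ^ 6 = (q * (3 * q ^ 2)) ^ 2"
      by (simp add: eval_nat_numeral algebra_simps)
    also have "\<dots> \<le> (q * (4 * (q ^ 2 - 1))) ^ 2"
      by (intro power_mono mult_le_mono2 le) simp_all
    also have "\<dots> = 16 * (q * (q ^ 2 - 1)) ^ 2" by (simp add: power_mult_distrib)
    finally show False by simp
  qed
  moreover have "real (card (pverts (Gamma \<alpha>))) = 2 ^ (2 * f) * (2 ^ (2 * f) - 1)\<^sup>2 / 3"
  proof -
    have "real (card (pverts (Gamma \<alpha>))) * 3 = real ((q * (q ^ 2 - 1)) ^ 2)"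
      using arg_cong[OF card, of real] by simp
    also have "\<dots> = real q ^ 2 * (real q ^ 2 - 1) ^ 2"
      using \<open>4 \<le> q ^ 2\<close> by (simp add: power_mult_distrib of_nat_diff)
    also have "real q ^ 2 = 2 ^ (2 * f)"
      by (simp add: q_def mult.commute flip: power_mult)
    finally show ?thesis by simp
  qed
  moreover have "bipartite (Gamma \<alpha>)"
    unfolding bipartite_def using Gamma_bipartition[OF char2] by blast
  ultimately show ?thesis
    using Gamma_pair_graph[OF char2] Gamma_cubic[OF char2] Gamma_bipartition[OF char2]
      Gamma_G_plus[OF char2] Gamma_action_hom[OF char2] Gamma_action_faithful[OF char2]
    by simp
qed

end
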